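(* Let $\mathcal X,\mathcal Y,\mathcal Z$ be sets, let $\pi:\mathcal X\to\mathcal Y$ and $\rho:\mathcal Y\to\mathcal Z$ be arbitrary maps, and let $E:\mathcal X\to(-\infty,+\infty]$. Then $$(\rho\circ\pi)_!E=\rho_!(\pi_!E).$$ For every $\ell:\mathcal Y\to(-\infty,+\infty]$ for which the sums below are defined, $$\inf_{x\in\mathcal X}\{E(x)+\ell(\pi(x))\}=\inf_{y\in\mathcal Y}\{(\pi_!E)(y)+\ell(y)\}.$$ Moreover, for every function $\varphi:\mathcal Y\to(-\infty,+\infty]$ for which the sums below are defined, and every subset $\mathcal C\subseteq\mathcal X$, $$\pi_!(E+\varphi\circ\pi)=\pi_!E+\varphi,$$ $$\pi_!(E+\iota_{\mathcal C})(y)=\inf_{\substack{\pi(x)=y\\ x\in\mathcal C}}E(x)\qquad\text{for all }y\in\mathcal Y.$$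
   Context: For a map $\pi:\mathcal X\to\mathcal Y$ and an extended-real-valued function $E$ on $\mathcal X$, the infimal pushforward is $(\pi_!E)(y):=\inf_{\pi(x)=y}E(x)$, with the convention $\inf\varnothing=+\infty$. It may take the value $-\infty$, and the same formula defines $\rho_!$ on functions with values in $[-\infty,+\infty]$. The function $\iota_{\mathcal C}$ is the indicator energy of $\mathcal C$: $\iota_{\mathcal C}(x)=0$ if $x\in\mathcal C$ and $+\infty$ otherwise. A sum is "defined" if it never has the form $(+\infty)+(-\infty)$. *)

theory Defs
  imports "HOL-Library.Extended_Real" "HOL-Library.FuncSet"
begin

text \<open>
  The infimal pushforward of \<open>E\<close> along \<open>\<pi>\<close>. The domain \<open>X\<close> of \<open>\<pi>\<close> is an explicit carrier, so
  that empty domains are covered. The infimum is taken in the complete lattice \<open>ereal\<close>, so it is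
  \<open>\<infinity>\<close> on an empty fibre.
\<close>

definition inf_pushforward :: "'x set \<Rightarrow> ('x \<Rightarrow> 'y) \<Rightarrow> ('x \<Rightarrow> ereal) \<Rightarrow> 'y \<Rightarrow> ereal"
  where "inf_pushforward X \<pi> E y = (INF x\<in>{x \<in> X. \<pi> x = y}. E x)"

definition indicator_energy :: "'x set \<Rightarrow> 'x \<Rightarrow> ereal"
  where "indicator_energy C x = (if x \<in> C then 0 else \<infinity>)"

text \<open>
  Addition on \<open>ereal\<close> is total, with \<open>\<infinity> + (-\<infinity>) = \<infinity>\<close>; this predicate excludes that case, in
  either order.
\<close>

definition sum_defined :: "ereal \<Rightarrow> ereal \<Rightarrow> bool"
  where "sum_defined a b \<longleftrightarrow> \<not> (a = \<infinity> \<and> b = -\<infinity>) \<and> \<not> (a = -\<infinity> \<and> b = \<infinity>)"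

end

theory Submission
  imports Defs
begin

text \<open>
  The fibres of \<open>\<pi>\<close> over a set \<open>B\<close> partition the preimage of \<open>B\<close>, and an infimum over a union is
  the infimum of the infima over its pieces. So minimising a pushforward over \<open>B\<close> is minimising
  the original function over the preimage of \<open>B\<close> (\<open>INF_inf_pushforward\<close>). With \<open>B\<close> a fibre of
  \<open>\<rho>\<close> this is functoriality, and with \<open>B\<close> all of \<open>Y\<close> it says that the pushforward has the same
  total infimum.

  On one fibre of \<open>\<pi>\<close> the function \<open>\<phi> \<circ> \<pi>\<close> is a constant other than \<open>-\<infinity>\<close>, and such a constant
  can be pulled out of an infimum (\<open>INF_ereal_add_const\<close>). This is the projection formula for
  \<open>E + \<phi> \<circ> \<pi>\<close>, and taking total infima in it gives the identity for \<open>l\<close>. Adding the indicator of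
  \<open>C\<close> raises \<open>E\<close> to the top element outside \<open>C\<close>, where it no longer influences an infimum.
\<close>

text \<open>
  A finite constant is cancelled by subtracting it again. For \<open>c = \<infinity>\<close> both sides are \<open>\<infinity>\<close>, even
  if \<open>f\<close> is unbounded below, because in \<open>ereal\<close> the sum \<open>-\<infinity> + \<infinity>\<close> is \<open>\<infinity>\<close>.
\<close>

lemma INF_ereal_add_const:
  fixes f :: "'a \<Rightarrow> ereal"
  assumes "c \<noteq> -\<infinity>"
  shows "(INF x\<in>A. f x + c) = (INF x\<in>A. f x) + c"
proof (cases c)
  case (real r)
  show ?thesis
  proof (rule antisym)
    have "(INF x\<in>A. f x + c) - c \<le> f x" if "x \<in> A" for x
    proof -
      have "(INF x\<in>A. f x + c) \<le> f x + c"
        using that by (rule INF_lower)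
      then show ?thesis
        by (simp add: real ereal_minus_le)
    qed
    then have "(INF x\<in>A. f x + c) - c \<le> (INF x\<in>A. f x)"
      by (rule INF_greatest)
    then show "(INF x\<in>A. f x + c) \<le> (INF x\<in>A. f x) + c"
      by (simp add: real ereal_minus_le)
    show "(INF x\<in>A. f x) + c \<le> (INF x\<in>A. f x + c)"
      by (intro INF_greatest add_right_mono INF_lower)
  qed
next
  case PInf
  then show ?thesis
    by (cases "A = {}") (simp_all add: top_ereal_def)
next
  case MInf
  with assms show ?thesis by simp
qed

lemma INF_inf_pushforward:
  "(INF y\<in>B. inf_pushforward X \<pi> F y) = (INF x\<in>{x \<in> X. \<pi> x \<in> B}. F x)"
proof (rule antisym)
  show "(INF y\<in>B. inf_pushforward X \<pi> F y) \<le> (INF x\<in>{x \<in> X. \<pi> x \<in> B}. F x)"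
    unfolding inf_pushforward_def by (auto intro!: INF_greatest INF_lower2)
  show "(INF x\<in>{x \<in> X. \<pi> x \<in> B}. F x) \<le> (INF y\<in>B. inf_pushforward X \<pi> F y)"
    unfolding inf_pushforward_def by (auto intro!: INF_greatest INF_lower)
qed

lemma inf_pushforward_comp:
  assumes "\<pi> \<in> X \<rightarrow> Y"
  shows "inf_pushforward X (\<rho> \<circ> \<pi>) E z = inf_pushforward Y \<rho> (inf_pushforward X \<pi> E) z"
proof -
  have "inf_pushforward Y \<rho> (inf_pushforward X \<pi> E) z
      = (INF x\<in>{x \<in> X. \<pi> x \<in> {y \<in> Y. \<rho> y = z}}. E x)"
    unfolding inf_pushforward_def[of Y] by (rule INF_inf_pushforward)
  also have "{x \<in> X. \<pi> x \<in> {y \<in> Y. \<rho> y = z}} = {x \<in> X. (\<rho> \<circ> \<pi>) x = z}"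
    using assms by auto
  finally show ?thesis
    by (simp only: inf_pushforward_def)
qed

lemma inf_pushforward_add_comp:
  assumes "\<phi> y \<noteq> -\<infinity>"
  shows "inf_pushforward X \<pi> (\<lambda>x. E x + \<phi> (\<pi> x)) y = inf_pushforward X \<pi> E y + \<phi> y"
proof -
  have "inf_pushforward X \<pi> (\<lambda>x. E x + \<phi> (\<pi> x)) y
      = (INF x\<in>{x \<in> X. \<pi> x = y}. E x + \<phi> y)"
    unfolding inf_pushforward_def by (rule INF_cong) auto
  with assms show ?thesis
    by (simp add: inf_pushforward_def INF_ereal_add_const)
qed

lemma INF_add_comp_eq_INF_inf_pushforward:
  assumes "\<pi> \<in> X \<rightarrow> Y" and "\<And>y. y \<in> Y \<Longrightarrow> l y \<noteq> -\<infinity>"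
  shows "(INF x\<in>X. E x + l (\<pi> x)) = (INF y\<in>Y. inf_pushforward X \<pi> E y + l y)"
proof -
  have "{x \<in> X. \<pi> x \<in> Y} = X"
    using assms(1) by auto
  then have "(INF x\<in>X. E x + l (\<pi> x))
      = (INF y\<in>Y. inf_pushforward X \<pi> (\<lambda>x. E x + l (\<pi> x)) y)"
    by (simp add: INF_inf_pushforward)
  also have "\<dots> = (INF y\<in>Y. inf_pushforward X \<pi> E y + l y)"
    by (rule INF_cong) (simp_all add: assms(2) inf_pushforward_add_comp)
  finally show ?thesis .
qed

lemma inf_pushforward_add_indicator_energy:
  "inf_pushforward X \<pi> (\<lambda>x. E x + indicator_energy C x) y
    = (INF x\<in>{x \<in> X. \<pi> x = y \<and> x \<in> C}. E x)"
proof (rule antisym)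
  show "inf_pushforward X \<pi> (\<lambda>x. E x + indicator_energy C x) y
      \<le> (INF x\<in>{x \<in> X. \<pi> x = y \<and> x \<in> C}. E x)"
    unfolding inf_pushforward_def
    by (rule INF_mono) (auto simp: indicator_energy_def)
  show "(INF x\<in>{x \<in> X. \<pi> x = y \<and> x \<in> C}. E x)
      \<le> inf_pushforward X \<pi> (\<lambda>x. E x + indicator_energy C x) y"
    unfolding inf_pushforward_def
    by (rule INF_greatest) (auto simp: indicator_energy_def intro: INF_lower)
qed

theorem theorem1:
  fixes X :: "'x set" and Y :: "'y set" and Z :: "'z set"
    and \<pi> :: "'x \<Rightarrow> 'y" and \<rho> :: "'y \<Rightarrow> 'z" and E :: "'x \<Rightarrow> ereal"
  assumes "\<pi> \<in> X \<rightarrow> Y" and "\<rho> \<in> Y \<rightarrow> Z" and "E \<in> X \<rightarrow> {-\<infinity><..}"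
  shows "(\<forall>z\<in>Z. inf_pushforward X (\<rho> \<circ> \<pi>) E z
            = inf_pushforward Y \<rho> (inf_pushforward X \<pi> E) z)
    \<and> (\<forall>l \<in> Y \<rightarrow> {-\<infinity><..}.
          (\<forall>x\<in>X. sum_defined (E x) (l (\<pi> x))) \<longrightarrow>
          (\<forall>y\<in>Y. sum_defined (inf_pushforward X \<pi> E y) (l y)) \<longrightarrow>
          (INF x\<in>X. E x + l (\<pi> x)) = (INF y\<in>Y. inf_pushforward X \<pi> E y + l y))
    \<and> (\<forall>\<phi> \<in> Y \<rightarrow> {-\<infinity><..}.
          (\<forall>x\<in>X. sum_defined (E x) ((\<phi> \<circ> \<pi>) x)) \<longrightarrow>
          (\<forall>y\<in>Y. sum_defined (inf_pushforward X \<pi> E y) (\<phi> y)) \<longrightarrow>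
          (\<forall>y\<in>Y. inf_pushforward X \<pi> (\<lambda>x. E x + (\<phi> \<circ> \<pi>) x) y
              = inf_pushforward X \<pi> E y + \<phi> y))
    \<and> (\<forall>C. C \<subseteq> X \<longrightarrow>
          (\<forall>y\<in>Y. inf_pushforward X \<pi> (\<lambda>x. E x + indicator_energy C x) y
              = (INF x\<in>{x \<in> X. \<pi> x = y \<and> x \<in> C}. E x)))"
proof (intro conjI ballI allI impI)
  fix z
  show "inf_pushforward X (\<rho> \<circ> \<pi>) E z = inf_pushforward Y \<rho> (inf_pushforward X \<pi> E) z"
    using assms(1) by (rule inf_pushforward_comp)
next
  fix l :: "'y \<Rightarrow> ereal"
  assume "l \<in> Y \<rightarrow> {-\<infinity><..}"
  then have "\<And>y. y \<in> Y \<Longrightarrow> l y \<noteq> -\<infinity>"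
    by fastforce
  with assms(1) show "(INF x\<in>X. E x + l (\<pi> x)) = (INF y\<in>Y. inf_pushforward X \<pi> E y + l y)"
    by (rule INF_add_comp_eq_INF_inf_pushforward)
next
  fix \<phi> :: "'y \<Rightarrow> ereal" and y
  assume "\<phi> \<in> Y \<rightarrow> {-\<infinity><..}" and "y \<in> Y"
  then have "\<phi> y \<noteq> -\<infinity>"
    by fastforce
  then show "inf_pushforward X \<pi> (\<lambda>x. E x + (\<phi> \<circ> \<pi>) x) y = inf_pushforward X \<pi> E y + \<phi> y"
    by (simp add: inf_pushforward_add_comp)
next
  fix C y
  show "inf_pushforward X \<pi> (\<lambda>x. E x + indicator_energy C x) y
      = (INF x\<in>{x \<in> X. \<pi> x = y \<and> x \<in> C}. E x)"
    by (rule inf_pushforward_add_indicator_energy)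
qed

end
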